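(* The characteristic number of a cubic is $-1$. That is, let $\Gamma_3$ be an algebraic curve of degree $3$ (a cubic) in the projective plane $\mathbb{P}^2$, and let $a,b,c$ be any three distinct lines with no common zero (no point common to all three), none of which is a component of $\Gamma_3$. Suppose that each of the lines $a,b,c$ has three intersections with $\Gamma_3$, and let $p_1,p_2,p_3$ be the intersections of $\Gamma_3$ with $a$, $p_4,p_5,p_6$ those with $b$, and $p_7,p_8,p_9$ those with $c$. Let $u=c\cap a$, $v=a\cap b$, $w=b\cap c$. Then $$\mathcal{K}_3(\Gamma_3):=[u,v;p_1,p_2,p_3]\cdot[v,w;p_4,p_5,p_6]\cdot[w,u;p_7,p_8,p_9]=-1 .$$
   Context: An algebraic curve of degree $n$ in the projective plane $\mathbb{P}^2$ is the solution set of a homogeneous polynomial equation $P(x,y,z)=0$ of degree $n$, in real or complex variables. Points of $\mathbb{P}^2$ are given by homogeneous coordinate triples; the same triples representing $u,v,w$ are used in all three factors of the product. Characteristic ratio: let $s,t\in\mathbb{P}^2$ be two distinct points and let $p_1,\dots,p_k$ be points on the line joining $s$ and $t$. Then there are numbers $a_i,b_i$ such that $p_i=a_is+b_it$, $i=1,\dots,k$. The ratio $$[s,t;p_1,\dots,p_k]:=\frac{b_1b_2\cdots b_k}{a_1a_2\cdots a_k}$$ is called the characteristic ratio of $p_1,\dots,p_k$ with respect to the basic points $s,t$. If there are multiple points among the intersection points, the corresponding characteristic ratio is defined by its limit form (so a multiple intersection point is repeated according to its multiplicity). The number $\mathcal{K}_3(\Gamma_3)$ defined by the product in the claim is called the characteristic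 number of the cubic $\Gamma_3$. *)

theory Defs
  imports
    "HOL-Analysis.Analysis"
    "HOL-Computational_Algebra.Polynomial"
    "HOL-Library.Poly_Mapping"
begin

(* Ternary polynomials: finitely supported maps from exponent vectors to coefficients.
   The exponent of the i-th homogeneous coordinate is the value at i :: 3. *)
type_synonym 'a ternary = "(3 \<Rightarrow>\<^sub>0 nat) \<Rightarrow>\<^sub>0 'a"

definition homogeneous :: "nat \<Rightarrow> 'a::zero ternary \<Rightarrow> bool" where
  "homogeneous n P \<longleftrightarrow>
     (\<forall>m\<in>Poly_Mapping.keys P. (\<Sum>i\<in>UNIV. Poly_Mapping.lookup m i) = n)"

definition eval :: "'a::comm_semiring_1 ternary \<Rightarrow> 'a^3 \<Rightarrow> 'a" where
  "eval P x = (\<Sum>m\<in>Poly_Mapping.keys P. Poly_Mapping.lookup P m *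
                  (\<Prod>i\<in>UNIV. x $ i ^ Poly_Mapping.lookup m i))"

(* Points of the projective plane are represented by nonzero coordinate triples;
   two triples represent the same point iff they are proportional. *)
definition same_point :: "'a::field^3 \<Rightarrow> 'a^3 \<Rightarrow> bool" where
  "same_point p q \<longleftrightarrow> (\<exists>k. k \<noteq> 0 \<and> p = k *s q)"

definition curve :: "'a::field ternary \<Rightarrow> ('a^3) set" where
  "curve P = {x. x \<noteq> 0 \<and> eval P x = 0}"

(* A line is given by its nonzero coefficient vector. The sum is bilinear over 'a;
   it is not the (real-valued) library inner product, which would be wrong over complex. *)
definition line :: "'a::field^3 \<Rightarrow> ('a^3) set" where
  "line l = {x. x \<noteq> 0 \<and> (\<Sum>i\<in>UNIV. l $ i * x $ i) = 0}"

definition linear_form :: "'a::field^3 \<Rightarrow> 'a ternary" where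
  "linear_form l =
     (\<Sum>i\<in>UNIV. Poly_Mapping.single (Poly_Mapping.single i 1) (l $ i))"

definition is_component :: "'a::field^3 \<Rightarrow> 'a ternary \<Rightarrow> bool" where
  "is_component l P \<longleftrightarrow> linear_form l dvd P"

(* The univariate polynomial P(p + T q) in T. *)
definition restrict_poly :: "'a::field ternary \<Rightarrow> 'a^3 \<Rightarrow> 'a^3 \<Rightarrow> 'a poly" where
  "restrict_poly P p q = (\<Sum>m\<in>Poly_Mapping.keys P. smult (Poly_Mapping.lookup P m)
                            (\<Prod>i\<in>UNIV. [:p $ i, q $ i:] ^ Poly_Mapping.lookup m i))"

lemma poly_restrict_poly: "poly (restrict_poly P p q) t = eval P (p + t *s q)"
  by (simp add: restrict_poly_def eval_def poly_sum poly_prod)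

(* Multiplicity at p of the intersection of P = 0 with the line joining the distinct points
   p and q. For homogeneous P not vanishing identically on that line, it does not depend on
   the choice of q on the line, nor on the triples representing p and q. *)
definition intersection_mult :: "'a::field ternary \<Rightarrow> 'a^3 \<Rightarrow> 'a^3 \<Rightarrow> nat" where
  "intersection_mult P p q = order 0 (restrict_poly P p q)"

(* ps lists all intersections of the line l with the curve of P, each point repeated
   according to its intersection multiplicity (points off the curve have multiplicity 0). *)
definition intersections :: "'a::field ternary \<Rightarrow> 'a^3 \<Rightarrow> ('a^3) list \<Rightarrow> bool" where
  "intersections P l ps \<longleftrightarrow> set ps \<subseteq> line l \<and>
     (\<forall>p\<in>line l. \<forall>q\<in>line l. \<not> same_point p q \<longrightarrow>
        length (filter (same_point p) ps) = intersection_mult P p q)"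

(* Meaningful for linearly independent s, t and p in their span. *)
definition coords :: "'a::field^3 \<Rightarrow> 'a^3 \<Rightarrow> 'a^3 \<Rightarrow> 'a \<times> 'a" where
  "coords s t p = (THE ab. p = fst ab *s s + snd ab *s t)"

(* The ratio is defined only when no point of ps is t; otherwise the division yields 0. *)
definition char_ratio :: "'a::field^3 \<Rightarrow> 'a^3 \<Rightarrow> ('a^3) list \<Rightarrow> 'a" where
  "char_ratio s t ps =
     (\<Prod>p\<leftarrow>ps. snd (coords s t p)) / (\<Prod>p\<leftarrow>ps. fst (coords s t p))"

end

theory Submission imports Defs begin

text \<open>On a line through \<open>u\<close> and \<open>v\<close> the cubic restricts to the univariate polynomial
  \<open>P(u + T v)\<close>, whose constant coefficient is \<open>P(u)\<close>, whose coefficient of \<open>T^3\<close> is \<open>P(v)\<close>, and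
  whose roots are the quotients \<open>b_i / a_i\<close> of the coordinates of the intersections. By Vieta the
  characteristic ratio is \<open>- P(u) / P(v)\<close>, and the product over the three lines telescopes.\<close>

section \<open>Univariate polynomials: translation, root multisets and Vieta's formula\<close>

lemma pcompose_power:
  fixes p q :: "'a::comm_semiring_1 poly"
  shows "(p ^ n) \<circ>\<^sub>p q = (p \<circ>\<^sub>p q) ^ n"
  by (induction n) (simp_all add: pcompose_mult pcompose_1)

text \<open>Translation carries the factor \<open>[:- t, 1:]\<close> to the variable and keeps the
  cofactor nonzero at the corresponding point. This is needed because
  \<open>intersection_mult\<close> always measures the order at 0.\<close>

lemma order_pcompose_translate:
  fixes p :: "'a::field poly"
  assumes "p \<noteq> 0"
  shows "order 0 (p \<circ>\<^sub>p [:t, 1:]) = order t p"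
proof -
  obtain q where q: "p = [:- t, 1:] ^ order t p * q" "\<not> [:- t, 1:] dvd q"
    using order_decomp[OF assms] by blast
  \<comment> \<open>The root is written \<open>- 0\<close> to fit the shape that
    \<open>order_unique_lemma\<close> expects.\<close>
  have shift: "p \<circ>\<^sub>p [:t, 1:] = [:- 0, 1:] ^ order t p * (q \<circ>\<^sub>p [:t, 1:])"
    by (subst q(1)) (simp add: pcompose_mult pcompose_power pcompose_pCons)
  have "poly (q \<circ>\<^sub>p [:t, 1:]) 0 \<noteq> 0"
    using q(2) by (simp add: poly_pcompose poly_eq_0_iff_dvd)
  then have "\<not> [:- 0, 1:] ^ Suc (order t p) dvd p \<circ>\<^sub>p [:t, 1:]"
    unfolding shift power_Suc2 by (subst dvd_mult_cancel_left) (simp add: poly_eq_0_iff_dvd)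
  moreover have "[:- 0, 1:] ^ order t p dvd p \<circ>\<^sub>p [:t, 1:]"
    unfolding shift by (rule dvd_triv_left)
  ultimately show ?thesis
    by (metis order_unique_lemma)
qed

text \<open>Dividing by one linear factor removes exactly one copy of its root from
  \<open>proots p\<close>, so the multiset inclusion passes to the quotient.\<close>

lemma prod_linear_factors_dvd:
  fixes p :: "'a::field poly"
  assumes "p \<noteq> 0" and "mset ts \<subseteq># proots p"
  shows "(\<Prod>t\<leftarrow>ts. [:- t, 1:]) dvd p"
  using assms
proof (induction ts arbitrary: p)
  case Nil
  then show ?case by simp
next
  case (Cons t ts)
  have "t \<in># proots p"
    using Cons.prems(2) by (auto dest: mset_subset_eqD)
  then obtain q where q: "p = [:- t, 1:] * q"
    using Cons.prems(1) by (auto simp: poly_eq_0_iff_dvd)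
  then have "q \<noteq> 0"
    using Cons.prems(1) by auto
  moreover have "proots p = {#t#} + proots q"
    unfolding q using \<open>q \<noteq> 0\<close> by (subst proots_mult) auto
  ultimately have "(\<Prod>t\<leftarrow>ts. [:- t, 1:]) dvd q"
    using Cons.IH[of q] Cons.prems(2) by simp
  then show ?case
    unfolding q by (simp only: list.map prod_list.Cons mult_dvd_mono dvd_refl)
qed

text \<open>Vieta for the constant coefficient. The linear factors already exhaust the degree bound,
  so the cofactor is a constant.\<close>

lemma poly_0_eq_prod_roots:
  fixes p :: "'a::field poly"
  assumes "p \<noteq> 0" and "degree p \<le> length ts" and "mset ts = proots p"
  shows "poly p 0 = (- 1) ^ length ts * coeff p (length ts) * prod_list ts"
proof -
  let ?d = "\<Prod>t\<leftarrow>ts. [:- t, 1:]"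
  have lead: "degree (\<Prod>r\<leftarrow>rs. [:- r, 1:]) = length rs \<and>
      coeff (\<Prod>r\<leftarrow>rs. [:- r, 1:]) (length rs) = 1 \<and> (\<Prod>r\<leftarrow>rs. [:- r, 1:]) \<noteq> 0" for rs :: "'a list"
  proof (induction rs)
    case (Cons r rs)
    let ?e = "\<Prod>r\<leftarrow>rs. [:- r, 1:]"
    have "degree ([:- r, 1:] * ?e) = Suc (length rs)"
      using Cons by (subst degree_mult_eq) (auto simp del: mult_pCons_left)
    moreover have "lead_coeff ([:- r, 1:] * ?e) = 1"
      unfolding lead_coeff_mult using Cons by simp
    ultimately show ?case
      using Cons by (auto simp del: mult_pCons_left)
  qed simp
  obtain q where q: "p = ?d * q"
    using prod_linear_factors_dvd[of p ts] assms by auto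
  then have "degree p = length ts + degree q"
    using assms(1) lead[of ts] by (auto simp: degree_mult_eq)
  then have "degree q = 0"
    using assms(2) by simp
  then obtain k where k: "q = [:k:]"
    by (rule degree_eq_zeroE)
  have "poly ?d 0 = (- 1) ^ length ts * prod_list ts"
    by (induction ts) auto
  \<comment> \<open>As \<open>?d\<close> is monic of degree \<open>length ts\<close>, the constant
    \<open>k\<close> is the coefficient of \<open>p\<close> at that index.\<close>
  then show ?thesis
    using lead[of ts] by (simp add: q k)
qed

section \<open>Restriction of a form to a parametrized line\<close>

lemma degree_coeff_prod_linear_power:
  fixes p q :: "'i \<Rightarrow> 'a::comm_ring_1"
  assumes "finite A"
  shows "degree (\<Prod>i\<in>A. [:p i, q i:] ^ m i) \<le> sum m A \<and>
         coeff (\<Prod>i\<in>A. [:p i, q i:] ^ m i) (sum m A) = (\<Prod>i\<in>A. q i ^ m i)"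
proof -
  \<comment> \<open>Degree bounds replace exact degrees: some \<open>q i\<close> may vanish, and the
    coefficient at the bound is multiplicative even when it is 0.\<close>
  have mult: "degree (f * g) \<le> j + k \<and> coeff (f * g) (j + k) = coeff f j * coeff g k"
    if "degree f \<le> j" "degree g \<le> k" for f g :: "'a poly" and j k
  proof
    show "degree (f * g) \<le> j + k"
      using degree_mult_le[of f g] that by linarith
    \<comment> \<open>For \<open>i < j\<close> the index \<open>j + k - i\<close> exceeds
      \<open>k\<close>; for \<open>i > j\<close> the factor from \<open>f\<close> vanishes. Only
      \<open>i = j\<close> survives in the convolution.\<close>
    have "coeff f i * coeff g (j + k - i) = 0" if "i \<le> j + k" "i \<noteq> j" for i
      using that \<open>degree f \<le> j\<close> \<open>degree g \<le> k\<close>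
      by (cases "i < j") (auto simp: coeff_eq_0)
    then have "(\<Sum>i\<le>j + k. coeff f i * coeff g (j + k - i)) =
               (\<Sum>i\<in>{j}. coeff f i * coeff g (j + k - i))"
      by (intro sum.mono_neutral_right) auto
    then show "coeff (f * g) (j + k) = coeff f j * coeff g k"
      by (simp add: coeff_mult)
  qed
  have pow: "degree ([:a, b:] ^ k) \<le> k \<and> coeff ([:a, b:] ^ k) k = b ^ k" for a b :: 'a and k
  proof (induction k)
    case (Suc k)
    then show ?case
      using mult[of "[:a, b:]" 1 "[:a, b:] ^ k" k] by simp
  qed simp
  from assms show ?thesis
  proof (induction A rule: finite_induct)
    case (insert x A)
    then show ?case
      using mult[of "[:p x, q x:] ^ m x" "m x" "\<Prod>i\<in>A. [:p i, q i:] ^ m i" "sum m A"] pow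
      by simp
  qed simp
qed

text \<open>The power \<open>T^n\<close> arises from a monomial of degree \<open>n\<close> only by
  taking the \<open>T\<close>-term of every linear factor, which leaves that monomial evaluated at
  \<open>q\<close>.\<close>

lemma
  assumes "homogeneous n P"
  shows degree_restrict_poly_le: "degree (restrict_poly P p q) \<le> n"
    and coeff_restrict_poly: "coeff (restrict_poly P p q) n = eval P q"
proof -
  have m: "degree (\<Prod>i\<in>UNIV. [:p $ i, q $ i:] ^ Poly_Mapping.lookup m i) \<le> n \<and>
      coeff (\<Prod>i\<in>UNIV. [:p $ i, q $ i:] ^ Poly_Mapping.lookup m i) n =
        (\<Prod>i\<in>UNIV. q $ i ^ Poly_Mapping.lookup m i)" if "m \<in> Poly_Mapping.keys P" for m
    using degree_coeff_prod_linear_power[of UNIV "\<lambda>i. p $ i" "\<lambda>i. q $ i" "Poly_Mapping.lookup m"]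
      assms that by (simp add: homogeneous_def)
  show "degree (restrict_poly P p q) \<le> n"
    unfolding restrict_poly_def
    by (intro degree_sum_le) (auto intro: order_trans[OF degree_smult_le] simp: m)
  show "coeff (restrict_poly P p q) n = eval P q"
    unfolding restrict_poly_def eval_def by (simp add: coeff_sum m)
qed

text \<open>Moving the base point along the line shifts the parameter, so the intersection
  multiplicity at \<open>p + t *s q\<close> becomes the order at \<open>t\<close> of one fixed
  polynomial.\<close>

lemma restrict_poly_translate:
  "restrict_poly P (p + t *s q) q = restrict_poly P p q \<circ>\<^sub>p [:t, 1:]"
  by (simp add: restrict_poly_def pcompose_sum pcompose_prod pcompose_smult
      pcompose_power pcompose_pCons algebra_simps)

section \<open>Coordinates with respect to two points of a line\<close>

lemma independent_if_not_same_point: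
  assumes "s \<noteq> 0" and "t \<noteq> 0" and "\<not> same_point s t" and "x *s s + y *s t = 0"
  shows "x = 0 \<and> y = 0"
proof -
  have "x = 0"
  proof (rule ccontr)
    assume "x \<noteq> 0"
    have "x *s s = (- y) *s t"
      using assms(4) by (simp add: eq_neg_iff_add_eq_0)
    then have "(1 / x) *s (x *s s) = (1 / x) *s ((- y) *s t)"
      by simp
    then have s: "s = (- y / x) *s t"
      using \<open>x \<noteq> 0\<close> by (simp add: vector_smult_assoc)
    \<comment> \<open>\<open>same_point\<close> demands a nonzero scalar;
      \<open>s \<noteq> 0\<close> provides it.\<close>
    with assms(1) have "- y / x \<noteq> 0" by auto
    with s assms(3) show False
      unfolding same_point_def by blast
  qed
  with assms(2,4) show ?thesis
    by simp
qed

lemma coords_eq: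
  assumes "s \<noteq> 0" and "t \<noteq> 0" and "\<not> same_point s t" and "p = x *s s + y *s t"
  shows "coords s t p = (x, y)"
  unfolding coords_def
proof (rule the_equality)
  fix ab
  assume "p = fst ab *s s + snd ab *s t"
  then have "(fst ab - x) *s s + (snd ab - y) *s t = 0"
    using assms(4) by (simp add: vector_sub_rdistrib algebra_simps)
  from independent_if_not_same_point[OF assms(1-3) this] show "ab = (x, y)"
    by (auto simp: prod_eq_iff)
qed (use assms in simp)

text \<open>The matrix with rows \<open>p\<close>, \<open>s\<close>, \<open>t\<close> kills the
  nonzero vector \<open>l\<close>, so its rows are dependent; independence of \<open>s\<close> and
  \<open>t\<close> forces a nonzero coefficient at \<open>p\<close>.\<close>

lemma line_spanned:
  assumes "l \<noteq> 0" and "s \<in> line l" and "t \<in> line l" and "\<not> same_point s t" and "p \<in> line l"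
  obtains x y where "p = x *s s + y *s t"
proof -
  let ?A = "vector [p, s, t] :: 'a^3^3"
  have "?A *v l = 0"
    using assms by (simp add: vec_eq_iff matrix_vector_mult_def forall_3 line_def mult.commute)
  then have "\<not> (\<exists>B. B ** ?A = mat 1)"
    using assms(1) matrix_left_invertible_ker[of ?A] by blast
  \<comment> \<open>The kernel criterion concerns left inverses, the row criterion right inverses;
    for square matrices they exist together.\<close>
  then have "\<not> (\<exists>B. ?A ** B = mat 1)"
    by (metis matrix_left_right_inverse)
  then obtain k where k: "(\<Sum>i\<in>UNIV. k i *s row i ?A) = 0" "\<exists>i. k i \<noteq> 0"
    using matrix_right_invertible_independent_rows[of ?A] by blast
  have rows: "row 1 ?A = p" "row 2 ?A = s" "row 3 ?A = t"
    by (simp_all add: row_def)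
  have rel: "k 1 *s p + k 2 *s s + k 3 *s t = 0"
    using k(1) by (simp add: sum_3 rows)
  have "k 1 \<noteq> 0"
  proof
    assume "k 1 = 0"
    with rel have "k 2 = 0 \<and> k 3 = 0"
      using assms by (intro independent_if_not_same_point[of s t]) (auto simp: line_def)
    with \<open>k 1 = 0\<close> k(2) show False
      by (metis exhaust_3)
  qed
  have "k 1 *s p = - (k 2 *s s + k 3 *s t)"
    using rel by (simp only: eq_neg_iff_add_eq_0 add.assoc)
  then have "(1 / k 1) *s (k 1 *s p) = (1 / k 1) *s (- (k 2 *s s + k 3 *s t))"
    by simp
  then have "p = (- k 2 / k 1) *s s + (- k 3 / k 1) *s t"
    using \<open>k 1 \<noteq> 0\<close> by (simp add: vec_eq_iff field_simps)
  then show thesis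
    by (rule that)
qed

section \<open>The characteristic ratio on a single line\<close>

lemma same_point_sym: "same_point p q \<Longrightarrow> same_point q p"
  unfolding same_point_def
  by (metis left_inverse nonzero_imp_inverse_nonzero vector_smult_assoc vector_smult_lid)

text \<open>The points of the line other than \<open>t\<close> are the \<open>s + k *s t\<close>,
  with \<open>t\<close> itself at infinity. Comparing multiplicities at each \<open>k\<close>
  identifies the quotients \<open>y p / x p\<close> with the roots of \<open>?F\<close>.\<close>

lemma char_ratio_eq:
  assumes "homogeneous (length ps) P" and "intersections P l ps" and "l \<noteq> 0"
    and s: "s \<in> line l" and t: "t \<in> line l" and st: "\<not> same_point s t"
    and "s \<notin> curve P" and "t \<notin> curve P"
  shows "char_ratio s t ps = (- 1) ^ length ps * eval P s / eval P t"
proof -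
  let ?F = "restrict_poly P s t"
  define x where "x = (\<lambda>p. fst (coords s t p))"
  define y where "y = (\<lambda>p. snd (coords s t p))"
  have nz: "s \<noteq> 0" "t \<noteq> 0"
    using s t by (auto simp: line_def)
  have Ps: "eval P s \<noteq> 0" and Pt: "eval P t \<noteq> 0"
    using assms nz by (auto simp: curve_def)
  have poly_0: "poly (restrict_poly P p q) 0 = eval P p" for p q
    by (simp add: poly_restrict_poly)
  have F0: "?F \<noteq> 0"
    using poly_0[of s t] Ps by auto
  have ps: "p \<in> line l" if "p \<in> set ps" for p
    using assms(2) that by (auto simp: intersections_def)
  have mult: "length (filter (same_point p) ps) = order 0 (restrict_poly P p q)"
    if "p \<in> line l" "q \<in> line l" "\<not> same_point p q" for p q
    using assms(2) that by (auto simp: intersections_def intersection_mult_def)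
  have xy: "p = x p *s s + y p *s t" if p: "p \<in> line l" for p
  proof -
    obtain a b where "p = a *s s + b *s t"
      using line_spanned[OF assms(3) s t st p] .
    moreover from this have "coords s t p = (a, b)"
      by (rule coords_eq[OF nz st])
    ultimately show ?thesis by (simp add: x_def y_def)
  qed
  \<comment> \<open>A vanishing \<open>x p\<close> would make \<open>p\<close> the point
    \<open>t\<close>, yet \<open>t\<close> has multiplicity 0 because
    \<open>eval P t \<noteq> 0\<close>. Hence no quotient below is a division by zero.\<close>
  have x0: "x p \<noteq> 0" if "p \<in> set ps" for p
  proof
    assume "x p = 0"
    with xy[OF ps[OF that]] have p: "p = y p *s t"
      by simp
    have "p \<noteq> 0"
      using ps[OF that] by (simp add: line_def)
    with p have "same_point p t"
      unfolding same_point_def by (metis vector_smult_lzero)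
    then have "filter (same_point t) ps \<noteq> []"
      using that by (auto simp: filter_empty_conv dest: same_point_sym)
    moreover have "order 0 (restrict_poly P t s) = 0"
      using poly_0[of t s] Pt by (simp add: order_0I)
    ultimately show False
      using mult[OF t s] st same_point_sym[of t s] by auto
  qed
  have on_line: "s + k *s t \<in> line l" "\<not> same_point (s + k *s t) t" for k
  proof -
    have ne: "s + k *s t \<noteq> r *s t" for r
    proof
      assume "s + k *s t = r *s t"
      then have "1 *s s + (k - r) *s t = 0"
        by (simp add: vector_sub_rdistrib algebra_simps)
      from independent_if_not_same_point[OF nz st this] show False by simp
    qed
    from ne[of 0] have "s + k *s t \<noteq> 0" by simp
    then show "s + k *s t \<in> line l"
      using s t by (simp add: line_def algebra_simps sum.distrib flip: sum_distrib_left)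
    show "\<not> same_point (s + k *s t) t"
      using ne by (auto simp: same_point_def)
  qed
  have same: "same_point (s + k *s t) p \<longleftrightarrow> y p / x p = k" if "p \<in> set ps" for k p
  proof
    assume "same_point (s + k *s t) p"
    then obtain r where "s + k *s t = r *s p"
      by (auto simp: same_point_def)
    also have "r *s p = (r * x p) *s s + (r * y p) *s t"
      by (subst xy[OF ps[OF that]]) (simp add: vector_smult_assoc vector_add_ldistrib)
    finally have "(1 - r * x p) *s s + (k - r * y p) *s t = 0"
      by (simp add: vector_sub_rdistrib algebra_simps)
    from independent_if_not_same_point[OF nz st this] have "r * x p = 1" "k = r * y p"
      by auto
    then show "y p / x p = k"
      using x0[OF that] by (simp add: field_simps)
  next
    assume "y p / x p = k"
    \<comment> \<open>Normalizing the \<open>s\<close>-coordinate of \<open>p\<close> to 1 dictates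
      the scalar \<open>1 / x p\<close>.\<close>
    then have "s + k *s t = (1 / x p) *s (x p *s s + y p *s t)"
      using x0[OF that] by (simp add: vec_eq_iff field_simps)
    then show "same_point (s + k *s t) p"
      unfolding same_point_def xy[OF ps[OF that], symmetric]
      using x0[OF that] by (intro exI[of _ "1 / x p"]) simp
  qed
  let ?ts = "map (\<lambda>p. y p / x p) ps"
  have "mset ?ts = proots ?F"
  proof (rule multiset_eqI)
    fix k
    have "count (mset ?ts) k = length (filter (\<lambda>p. y p / x p = k) ps)"
      by (induction ps) auto
    also have "\<dots> = length (filter (same_point (s + k *s t)) ps)"
      using same by (intro arg_cong[where f = length] filter_cong) auto
    \<comment> \<open>Since \<open>s + k *s t\<close> differs from \<open>t\<close>, the latter can
      serve as second point of the line for every \<open>k\<close>.\<close>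
    also have "\<dots> = order 0 (restrict_poly P (s + k *s t) t)"
      using on_line t by (intro mult)
    also have "\<dots> = order k ?F"
      using F0 by (simp add: restrict_poly_translate order_pcompose_translate)
    finally show "count (mset ?ts) k = count (proots ?F) k"
      using F0 by simp
  qed
  \<comment> \<open>Vieta for \<open>?F\<close>, whose value at 0 is \<open>eval P s\<close> and
    whose coefficient at index \<open>length ps\<close> is \<open>eval P t\<close>.\<close>
  then have "eval P s = (- 1) ^ length ps * eval P t * prod_list ?ts"
    using poly_0_eq_prod_roots[OF F0, of ?ts] degree_restrict_poly_le[OF assms(1)]
      coeff_restrict_poly[OF assms(1)] poly_0[of s t] by simp
  moreover have "char_ratio s t ps = prod_list ?ts"
    unfolding char_ratio_def x_def y_def
  proof (induction ps)
    case (Cons p ps)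
    then show ?case
      by (simp add: mult.commute flip: Cons.IH)
  qed simp
  ultimately show ?thesis
    using Pt by (simp flip: power_mult_distrib mult.assoc)
qed

section \<open>The triangle formed by the three lines\<close>

lemma same_point_line: "same_point p q \<Longrightarrow> p \<in> line l \<Longrightarrow> q \<in> line l"
  by (auto simp: same_point_def line_def mult.left_commute simp flip: sum_distrib_left)

(* The class real_normed_field covers exactly the real and the complex case.
   That the vertices u, v, w are not on the curve is what makes all three ratios defined. *)
theorem theorem4p1:
  fixes P :: "'a::real_normed_field ternary"
    and a b c u v w p1 p2 p3 p4 p5 p6 p7 p8 p9 :: "'a^3"
  assumes "P \<noteq> 0" and "homogeneous 3 P"
    and "a \<noteq> 0" and "b \<noteq> 0" and "c \<noteq> 0"
    and "line a \<noteq> line b" and "line b \<noteq> line c" and "line c \<noteq> line a"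
    and "line a \<inter> line b \<inter> line c = {}"
    and "\<not> is_component a P" and "\<not> is_component b P" and "\<not> is_component c P"
    and "intersections P a [p1, p2, p3]"
    and "intersections P b [p4, p5, p6]"
    and "intersections P c [p7, p8, p9]"
    and "u \<in> line c \<inter> line a" and "v \<in> line a \<inter> line b" and "w \<in> line b \<inter> line c"
    and "u \<notin> curve P" and "v \<notin> curve P" and "w \<notin> curve P"
  shows "char_ratio u v [p1, p2, p3] * char_ratio v w [p4, p5, p6] *
         char_ratio w u [p7, p8, p9] = - 1"
proof -
  have nz: "eval P u \<noteq> 0" "eval P v \<noteq> 0" "eval P w \<noteq> 0"
    using assms(16-21) by (auto simp: curve_def line_def)
  \<comment> \<open>If two vertices coincided, their common point would lie on all three
    lines.\<close>
  have ns: "\<not> same_point u v" "\<not> same_point v w" "\<not> same_point w u"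
    using assms(9,16-18) by (auto dest: same_point_line same_point_sym)
  \<comment> \<open>\<open>char_ratio_eq\<close> reads the degree off the list length; unfolding
    numerals matches it with 3.\<close>
  have "char_ratio u v [p1, p2, p3] = (- 1) ^ length [p1, p2, p3] * eval P u / eval P v"
    by (rule char_ratio_eq[where l = a]) (use assms ns in \<open>simp_all add: eval_nat_numeral\<close>)
  moreover have "char_ratio v w [p4, p5, p6] = (- 1) ^ length [p4, p5, p6] * eval P v / eval P w"
    by (rule char_ratio_eq[where l = b]) (use assms ns in \<open>simp_all add: eval_nat_numeral\<close>)
  moreover have "char_ratio w u [p7, p8, p9] = (- 1) ^ length [p7, p8, p9] * eval P w / eval P u"
    by (rule char_ratio_eq[where l = c]) (use assms ns in \<open>simp_all add: eval_nat_numeral\<close>)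
  \<comment> \<open>Each odd power of \<open>- 1\<close> contributes a sign, and three signs leave
    \<open>- 1\<close>.\<close>
  ultimately show ?thesis
    using nz by simp
qed

end
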